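(* Let $X$ be a one-dimensional continuous characteristic and consider the one-dimensional policy class $\mathcal{G}=\{g:g(x)=\mathbf{1}\{x\le t\}\}$ of thresholds $t$ for $X$. Let $P$ be a distribution of $(\tau,C,X)$ under which the benefit satisfies $\tau>0$ almost surely and the cost $C\in\{0,1\}$ is binary. Suppose $C=0$ for $X\in[\underline{t},\overline{t}]$, but $\Pr_P\{C=1\mid X\}\in(0,1)$ otherwise. Suppose further that the budget threshold is $k=\mathbb{E}_P[C\cdot\mathbf{1}\{X\le\underline{t}\}]$. Then: (i) $P$ satisfies the following two conditions. Binding constraint: $B(g_P^{\ast};P)=k$. Separation: there exists $\epsilon>0$ such that for any feasible policy $g\in\mathcal{G}$ (i.e. $B(g;P)\le k$), whenever $|B(g;P)-B(g_P^{\ast};P)|>0$, we have $W(g_P^{\ast};P)-W(g;P)>\epsilon$. (ii) As $n\to\infty$, the sample-analog rule $\widehat{g}_{\text{sample}}$ violates the budget constraint with probability approaching 50%, i.e. $\Pr_{P^n}\{B(\widehat{g}_{\text{sample}};P)>k\}\to 50\%$, and there exists an $\epsilon>0$ such that it incurs at least an $\epsilon$ welfare loss with probability approaching 50%: $$\Pr_{P^n}\left\{W(g_P^{\ast};P)-W(\widehat{g}_{\text{sample}};P)\ge\epsilon\right\}\to 50\%.$$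
   Context: Define the welfare function $W(g;P)=\mathbb{E}_P[\tau\cdot g(X)]$ and the budget function $B(g;P)=\mathbb{E}_P[C\cdot g(X)]$, and let $g_P^{\ast}$ be a solution (assumed to exist) of $\max_{g\in\mathcal{G}}W(g;P)$ subject to $B(g;P)\le k$. The data are an i.i.d. sample $(\tau_i,C_i,X_i)$, $i=1,\dots,n$, from $P$ (benefit and cost are directly observed, so the only uncertainty is sampling error); $P^n$ is the distribution of the sample. Let $\widehat{W}_n(g)=\frac1n\sum_i\tau_i g(X_i)$ and $\widehat{B}_n(g)=\frac1n\sum_i C_i g(X_i)$. The sample-analog rule $\widehat{g}_{\text{sample}}$ is a maximizer of $\widehat{W}_n(g)$ over $\{g\in\mathcal{G}:\widehat{B}_n(g)\le k\}$; if no policy satisfies the sample constraint, $\widehat{g}_{\text{sample}}\equiv0$.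
   Formalization: The formal statement adds that X has positive probability of lying below the lower threshold, inside the interval where C=0, and above the upper threshold; if any of these probabilities is zero, the claim as worded fails. *)

theory Defs
  imports "HOL-Probability.Probability"
begin

text \<open>
  An observation is a triple (benefit, cost, characteristic); the distribution \<open>P\<close> of
  $(\tau, C, X)$ is a Borel probability measure on such triples, and $\tau$, $C$, $X$ are the
  coordinate maps. A sample of size \<open>n\<close> is a function on the index set \<open>{..<n}\<close>.
\<close>

type_synonym obs = "real \<times> real \<times> real"
type_synonym policy = "real \<Rightarrow> real"

definition benefit :: "obs \<Rightarrow> real" where
  "benefit z = fst z"

definition cost :: "obs \<Rightarrow> real" where
  "cost z = fst (snd z)"

definition charac :: "obs \<Rightarrow> real" where
  "charac z = snd (snd z)"

definition welfare :: "obs measure \<Rightarrow> policy \<Rightarrow> real" where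
  "welfare P g = (\<integral>z. benefit z * g (charac z) \<partial>P)"

definition budget :: "obs measure \<Rightarrow> policy \<Rightarrow> real" where
  "budget P g = (\<integral>z. cost z * g (charac z) \<partial>P)"

definition threshold_policies :: "policy set" where
  "threshold_policies = range (\<lambda>t::real. indicator {..t})"

definition is_constrained_max :: "policy set \<Rightarrow> (policy \<Rightarrow> real) \<Rightarrow> (policy \<Rightarrow> real) \<Rightarrow> real \<Rightarrow> policy \<Rightarrow> bool"
  where
  "is_constrained_max G W B k g \<longleftrightarrow>
     g \<in> G \<and> B g \<le> k \<and> (\<forall>g'\<in>G. B g' \<le> k \<longrightarrow> W g' \<le> W g)"

definition sample_distr :: "obs measure \<Rightarrow> nat \<Rightarrow> (nat \<Rightarrow> obs) measure" where
  "sample_distr P n = PiM {..<n} (\<lambda>_. P)"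

definition sample_welfare :: "nat \<Rightarrow> (nat \<Rightarrow> obs) \<Rightarrow> policy \<Rightarrow> real" where
  "sample_welfare n s g = (1 / real n) * (\<Sum>i<n. benefit (s i) * g (charac (s i)))"

definition sample_budget :: "nat \<Rightarrow> (nat \<Rightarrow> obs) \<Rightarrow> policy \<Rightarrow> real" where
  "sample_budget n s g = (1 / real n) * (\<Sum>i<n. cost (s i) * g (charac (s i)))"

text \<open>
  The sample problem generally has many maximizers (the threshold can move freely between adjacent
  observations), so being a sample-analog choice is a property of a policy, not a function of the
  sample.
\<close>

definition is_sample_analog :: "policy set \<Rightarrow> real \<Rightarrow> nat \<Rightarrow> (nat \<Rightarrow> obs) \<Rightarrow> policy \<Rightarrow> bool" where
  "is_sample_analog G k n s g \<longleftrightarrow>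
     (if \<exists>g'\<in>G. sample_budget n s g' \<le> k
      then is_constrained_max G (sample_welfare n s) (sample_budget n s) k g
      else g = (\<lambda>_. 0))"

text \<open>A version of $\Pr_P\{C = 1 \mid X\}$, as a random variable on observations.\<close>

definition cost_prob_given_charac :: "obs measure \<Rightarrow> obs \<Rightarrow> real" where
  "cost_prob_given_charac P =
     real_cond_exp P (vimage_algebra (space P) charac borel) (indicator {z. cost z = 1})"

end

theory Submission
  imports Defs "HOL-Real_Asymp.Real_Asymp"
begin

text \<open>
  Let $S_n$ be the number of costly sample points with $X_i \leq \underline{t}$; it is binomial
  with mean $nk$ and $0 < k < 1$. If $S_n > nk$, the sample rule must stop strictly below
  $\underline{t}$: it respects the true budget but forgoes the benefits on
  $[\underline{t}, \overline{t}]$. If $S_n \leq nk - 1$, it can afford the first observation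
  above $\overline{t}$, even if that costs one more unit, and takes it because benefits are
  positive; almost surely this means that it overspends and loses no welfare. By the central limit theorem both events have probability tending to $1/2$.
\<close>


section \<open>The standard normal distribution function\<close>

lemma measure_std_normal_singleton: "measure std_normal_distribution {x} = 0"
proof -
  have "emeasure std_normal_distribution {x} = 0"
    by (subst emeasure_density) (auto simp: nn_integral_indicator_singleton)
  then show ?thesis by (simp add: measure_def)
qed

lemma isCont_cdf_std_normal: "isCont (cdf std_normal_distribution) x"
proof -
  interpret real_distribution std_normal_distribution by (rule real_dist_normal_dist)
  show ?thesis by (simp add: isCont_cdf measure_std_normal_singleton)
qed

text \<open>The density is even, so reflection gives the two open half-lines equal mass, and the
  point between them is null. This is where the limit 1/2 comes from.\<close>

lemma cdf_std_normal_0: "cdf std_normal_distribution 0 = 1 / 2"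
proof -
  interpret N: real_distribution std_normal_distribution by (rule real_dist_normal_dist)
  have "emeasure std_normal_distribution {..<0} = emeasure std_normal_distribution {0<..}"
  proof -
    have "emeasure std_normal_distribution {..<0}
        = (\<integral>\<^sup>+x. ennreal (std_normal_density x) * indicator {..<0} x \<partial>distr lborel borel uminus)"
      by (simp add: emeasure_density lborel_distr_uminus)
    also have "\<dots> = (\<integral>\<^sup>+x. ennreal (std_normal_density x) * indicator {0<..} x \<partial>lborel)"
      by (subst nn_integral_distr)
         (auto intro!: nn_integral_cong simp: normal_density_def indicator_def)
    finally show ?thesis by (simp add: emeasure_density)
  qed
  then have sym: "N.prob {..<0} = N.prob {0<..}" by (simp add: measure_def)
  have "N.prob {..<0::real} + N.prob {0} = N.prob ({..<0} \<union> {0})"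
    by (subst N.finite_measure_Union) auto
  also have "{..<0} \<union> {0::real} = {..0}" by auto
  finally have le: "N.prob {..0} = N.prob {..<0}" by (simp add: measure_std_normal_singleton)
  have "N.prob {..0::real} + N.prob {0<..} = N.prob ({..0} \<union> {0<..})"
    by (subst N.finite_measure_Union) auto
  also have "{..0} \<union> {0::real<..} = space std_normal_distribution" by auto
  finally have "N.prob {..0} + N.prob {0<..} = 1" using N.prob_space by simp
  then show ?thesis using le sym by (simp add: cdf_def)
qed

text \<open>Weak convergence controls distribution functions at fixed points, whereas the central
  limit theorem is evaluated below at points moving with \<open>n\<close>. Monotonicity traps the
  moving value between two fixed points near \<open>l\<close>, where continuity of the limit takes
  over.\<close>

lemma weak_conv_m_cdf_tendsto:
  assumes M: "\<And>n. real_distribution (M n)" and lim: "weak_conv_m M N"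
    and cont: "\<And>y. isCont (cdf N) y" and x: "x \<longlonglongrightarrow> l"
  shows "(\<lambda>n. cdf (M n) (x n)) \<longlonglongrightarrow> cdf N l"
proof (rule LIMSEQ_I)
  fix e :: real assume e: "e > 0"
  have pt: "(\<lambda>n. cdf (M n) y) \<longlonglongrightarrow> cdf N y" for y
    using lim cont by (auto simp: weak_conv_m_def weak_conv_def)
  from cont[of l] e have "\<exists>d>0. \<forall>y. dist y l < d \<longrightarrow> dist (cdf N y) (cdf N l) < e / 2"
    unfolding continuous_at_eps_delta by (meson half_gt_zero)
  then obtain d where d: "d > 0" "\<And>y. dist y l < d \<Longrightarrow> dist (cdf N y) (cdf N l) < e / 2"
    by blast
  define a b where "a = l - d / 2" and "b = l + d / 2"
  have Na: "\<bar>cdf N a - cdf N l\<bar> < e / 2" and Nb: "\<bar>cdf N b - cdf N l\<bar> < e / 2"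
    using d(2)[of a] d(2)[of b] d(1) by (auto simp: a_def b_def dist_real_def)
  have "\<forall>\<^sub>F n in sequentially. dist (cdf (M n) a) (cdf N a) < e / 2"
       "\<forall>\<^sub>F n in sequentially. dist (cdf (M n) b) (cdf N b) < e / 2"
       "\<forall>\<^sub>F n in sequentially. dist (x n) l < d / 2"
    using pt[of a] pt[of b] x e d(1) by (auto intro!: tendstoD simp del: less_divide_eq_numeral1)
  then have "\<forall>\<^sub>F n in sequentially. norm (cdf (M n) (x n) - cdf N l) < e"
  proof eventually_elim
    case (elim n)
    interpret real_distribution "M n" by (rule M)
    have "a \<le> x n" "x n \<le> b" using elim(3) unfolding a_def b_def dist_real_def abs_less_iff by linarith+
    then have "cdf (M n) a \<le> cdf (M n) (x n)" "cdf (M n) (x n) \<le> cdf (M n) b"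
      by (auto intro: cdf_nondecreasing)
    with elim Na Nb show ?case unfolding dist_real_def real_norm_def by linarith
  qed
  then show "\<exists>no. \<forall>n\<ge>no. norm (cdf (M n) (x n) - cdf N l) < e"
    by (simp add: eventually_sequentially)
qed

section \<open>Independence, ties and misses in product samples\<close>

lemma indep_vars_PiM_component:
  assumes M: "\<And>i. i \<in> I \<Longrightarrow> prob_space (M i)" and I: "I \<noteq> {}"
  shows "prob_space.indep_vars (PiM I M) M (\<lambda>i \<omega>. \<omega> i) I"
proof -
  interpret prob_space "PiM I M" by (rule prob_space_PiM) (rule M)
  \<comment> \<open>Points of the product space are extensional, so restricting to \<open>I\<close>
    is the identity: the joint law of the coordinates is the product measure itself.\<close>
  have "distr (PiM I M) (PiM I M) (\<lambda>x. \<lambda>i\<in>I. x i) = distr (PiM I M) (PiM I M) (\<lambda>x. x)"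
    by (rule distr_cong) (auto simp: space_PiM PiE_def extensional_restrict)
  also have "\<dots> = PiM I (\<lambda>i. distr (PiM I M) (M i) (\<lambda>\<omega>. \<omega> i))"
    by (simp add: distr_id2) (rule PiM_cong, auto simp: distr_PiM_component M)
  finally show ?thesis
    by (subst indep_vars_iff_distr_eq_PiM') (use I in auto)
qed

text \<open>Two independent draws from an atomless law coincide with probability zero, and a finite
  sample has finitely many pairs. Absence of ties later ensures that a single observation comes
  first above \<open>t_hi\<close>.\<close>

lemma AE_PiM_inj_on:
  fixes X :: "'a \<Rightarrow> real"
  assumes P: "prob_space P" and I: "finite I" and X[measurable]: "X \<in> borel_measurable P"
    and cont: "\<And>x. measure P {z \<in> space P. X z = x} = 0"
  shows "AE s in PiM I (\<lambda>_. P). inj_on (\<lambda>i. X (s i)) I"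
proof -
  let ?M = "PiM I (\<lambda>_. P)"
  interpret P: prob_space P by fact
  interpret M: prob_space ?M by (rule prob_space_PiM) (rule P)
  have ne: "AE s in ?M. X (s i) \<noteq> X (s j)" if ij: "i \<in> I" "j \<in> I" "i \<noteq> j" for i j
  proof -
    let ?D = "distr P borel X"
    interpret D: prob_space ?D by (rule P.prob_space_distr) simp
    interpret DD: pair_sigma_finite ?D ?D ..
    have D: "distr ?M borel (\<lambda>s. X (s l)) = ?D" if "l \<in> I" for l
    proof -
      have "distr ?M borel (\<lambda>s. X (s l)) = distr (distr ?M P (\<lambda>s. s l)) borel X"
        using that by (subst distr_distr) (auto simp: comp_def)
      also have "distr ?M P (\<lambda>s. s l) = P" using that P by (intro distr_PiM_component)
      finally show ?thesis .
    qed
    have "M.indep_vars (\<lambda>_. P) (\<lambda>i s. s i) I"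
      by (rule indep_vars_PiM_component) (use P ij in auto)
    \<comment> \<open>Independence of two coordinates is read off from independence of the
      restrictions to the disjoint sets \<open>{i}\<close> and \<open>{j}\<close>.\<close>
    then have "M.indep_var (PiM {i} (\<lambda>_. P)) (\<lambda>s. restrict s {i}) (PiM {j} (\<lambda>_. P)) (\<lambda>s. restrict s {j})"
      by (rule M.indep_var_restrict) (use ij in auto)
    then have "M.indep_var borel ((\<lambda>f. X (f i)) \<circ> (\<lambda>s. restrict s {i}))
                           borel ((\<lambda>f. X (f j)) \<circ> (\<lambda>s. restrict s {j}))"
      by (rule M.indep_var_compose) measurable
    then have "M.indep_var borel (\<lambda>s. X (s i)) borel (\<lambda>s. X (s j))"
      by (simp add: comp_def)
    then have DDeq: "?D \<Otimes>\<^sub>M ?D = distr ?M (borel \<Otimes>\<^sub>M borel) (\<lambda>s. (X (s i), X (s j)))"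
      using ij by (simp add: M.indep_var_distribution_eq D)
    have "AE y in ?D. x \<noteq> y" for x
    proof -
      have "measure ?D {x} = 0"
        using cont[of x] by (subst measure_distr) (auto simp: vimage_def Int_def conj_commute)
      then have "{x} \<in> null_sets ?D" by (auto simp: null_sets_def D.emeasure_eq_measure)
      then have "AE y in ?D. y \<notin> {x}" by (rule AE_not_in)
      then show ?thesis by eventually_elim auto
    qed
    \<comment> \<open>Fubini: each slice of the diagonal is a singleton, hence null.\<close>
    then have "AE p in ?D \<Otimes>\<^sub>M ?D. fst p \<noteq> snd p"
    proof (intro DD.AE_pair_measure)
      show "{p \<in> space (?D \<Otimes>\<^sub>M ?D). fst p \<noteq> snd p} \<in> sets (?D \<Otimes>\<^sub>M ?D)"
        by measurable
    qed simp
    then show ?thesis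
      unfolding DDeq using ij by (subst (asm) AE_distr_iff) auto
  qed
  have "AE s in ?M. \<forall>i\<in>I. \<forall>j\<in>I. i \<noteq> j \<longrightarrow> X (s i) \<noteq> X (s j)"
    using I ne by (intro AE_finite_allI) auto
  then show ?thesis by eventually_elim (auto simp: inj_on_def)
qed

text \<open>By independence the probability is a power of \<open>1 - measure P A\<close>. With
  \<open>A\<close> the region above \<open>t_hi\<close>, it says that the sample eventually has an
  observation there.\<close>

lemma measure_PiM_all_not_in_tendsto_0:
  assumes P: "prob_space P" and A: "A \<in> sets P" "measure P A > 0"
  shows "(\<lambda>n. measure (PiM {..<n} (\<lambda>_. P)) {s \<in> space (PiM {..<n} (\<lambda>_. P)). \<forall>i<n. s i \<notin> A}) \<longlonglongrightarrow> 0"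
proof -
  interpret P: prob_space P by fact
  have "measure (PiM {..<n} (\<lambda>_. P)) {s \<in> space (PiM {..<n} (\<lambda>_. P)). \<forall>i<n. s i \<notin> A}
      = (1 - measure P A) ^ n" for n :: nat
  proof -
    interpret PP: product_prob_space "\<lambda>_. P" "{..<n}" by standard
    have "{s \<in> space (PiM {..<n} (\<lambda>_. P)). \<forall>i<n. s i \<notin> A}
        = {s \<in> space (PiM {..<n} (\<lambda>_. P)). \<forall>i\<in>{..<n}. s i \<in> space P - A}"
      by (auto simp: space_PiM)
    then have "emeasure (PiM {..<n} (\<lambda>_. P)) {s \<in> space (PiM {..<n} (\<lambda>_. P)). \<forall>i<n. s i \<notin> A}
       = ennreal ((1 - measure P A) ^ n)"
      using A by (simp only:) (subst PP.emeasure_PiM_Collect,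
        auto simp: P.emeasure_eq_measure P.prob_compl ennreal_power)
    then show ?thesis using P.prob_le_1[of A] by (subst measure_def) (simp del: measure_def)
  qed
  moreover have "(\<lambda>n. (1 - measure P A) ^ n) \<longlonglongrightarrow> 0"
    using A P.prob_le_1[of A] by (intro LIMSEQ_power_zero) auto
  ultimately show ?thesis by simp
qed

section \<open>The central limit theorem for samples of growing size\<close>

text \<open>A fixed shift \<open>c\<close> of the sum vanishes after division by its standard
  deviation, so the limit is the normal distribution function at 0 whatever \<open>c\<close> is. The
  central limit theorem concerns one infinite sequence; it is applied on the infinite product and
  then projected to the first \<open>n\<close> coordinates.\<close>

lemma iid_sum_le_tendsto_half:
  fixes f :: "'a \<Rightarrow> real" and c :: real
  assumes P: "prob_space P"
    and f[measurable]: "f \<in> borel_measurable P" and f2: "integrable P (\<lambda>z. (f z)\<^sup>2)"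
    and var: "prob_space.variance P f > 0"
  shows "(\<lambda>n. measure (PiM {..<n} (\<lambda>_. P))
            {s \<in> space (PiM {..<n} (\<lambda>_. P)). (\<Sum>i<n. f (s i)) \<le> real n * integral\<^sup>L P f + c}) \<longlonglongrightarrow> 1 / 2"
proof -
  interpret P: prob_space P by fact
  let ?M = "PiM (UNIV :: nat set) (\<lambda>_. P)"
  interpret PP: product_prob_space "\<lambda>_. P" "UNIV :: nat set" by standard
  define m \<sigma> where "m = integral\<^sup>L P f" and "\<sigma> = sqrt (P.variance f)"
  have \<sigma>: "\<sigma> > 0" "\<sigma>\<^sup>2 = P.variance f" using var by (auto simp: \<sigma>_def)
  have trans: "(\<integral>\<omega>. g (\<omega> i) \<partial>?M) = integral\<^sup>L P g" if "g \<in> borel_measurable P" for g :: "'a \<Rightarrow> real" and i :: nat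
  proof -
    have "integral\<^sup>L P g = integral\<^sup>L (distr ?M P (\<lambda>\<omega>. \<omega> i)) g" by (subst PP.PiM_component) auto
    then show ?thesis using that by (subst (asm) integral_distr) auto
  qed
  define S where "S n \<omega> = (\<Sum>i<n. f (\<omega> i) - m) / sqrt (n * \<sigma>\<^sup>2)" for n and \<omega> :: "nat \<Rightarrow> 'a"
  have S[measurable]: "S n \<in> borel_measurable ?M" for n unfolding S_def by measurable
  have "weak_conv_m (\<lambda>n. distr ?M borel (S n)) std_normal_distribution"
    unfolding S_def
  proof (rule PP.central_limit_theorem)
    have "PP.indep_vars (\<lambda>_. P) (\<lambda>i \<omega>. \<omega> i) UNIV"
      by (rule indep_vars_PiM_component) (use P in auto)
    then show "PP.indep_vars (\<lambda>_. borel) (\<lambda>i \<omega>. f (\<omega> i)) UNIV"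
      by (rule PP.indep_vars_compose2) simp
    show E: "PP.expectation (\<lambda>\<omega>. f (\<omega> n)) = m" for n
      by (simp add: trans m_def)
    show "\<sigma> > 0" by fact
    show "integrable ?M (\<lambda>\<omega>. (f (\<omega> n))\<^sup>2)" for n
    proof -
      have "integrable (distr ?M P (\<lambda>\<omega>. \<omega> n)) (\<lambda>z. (f z)\<^sup>2)" using f2 by (subst PP.PiM_component) auto
      then show ?thesis by (subst (asm) integrable_distr_eq) auto
    qed
    show "PP.variance (\<lambda>\<omega>. f (\<omega> n)) = \<sigma>\<^sup>2" for n
      using trans[of "\<lambda>z. (f z - m)\<^sup>2" n] by (simp add: E \<sigma>(2)) (simp add: m_def)
    show "distr ?M borel (\<lambda>\<omega>. f (\<omega> n)) = distr P borel f" for n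
    proof -
      have "distr ?M borel (\<lambda>\<omega>. f (\<omega> n)) = distr (distr ?M P (\<lambda>\<omega>. \<omega> n)) borel f"
        by (subst distr_distr) (auto simp: comp_def)
      then show ?thesis by (simp add: PP.PiM_component)
    qed
  qed
  moreover have "(\<lambda>n. c / sqrt (real n * \<sigma>\<^sup>2)) \<longlonglongrightarrow> 0"
  proof -
    have "(\<lambda>n. (c / \<sigma>) * (1 / sqrt (real n))) \<longlonglongrightarrow> (c / \<sigma>) * 0"
      by (intro tendsto_mult tendsto_const) real_asymp
    then show ?thesis using \<sigma>(1) by (simp add: real_sqrt_mult mult.commute)
  qed
  ultimately have "(\<lambda>n. cdf (distr ?M borel (S n)) (c / sqrt (real n * \<sigma>\<^sup>2))) \<longlonglongrightarrow> cdf std_normal_distribution 0"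
    by (intro weak_conv_m_cdf_tendsto) (auto intro: isCont_cdf_std_normal PP.real_distribution_distr)
  moreover have "cdf (distr ?M borel (S n)) (c / sqrt (real n * \<sigma>\<^sup>2))
      = measure (PiM {..<n} (\<lambda>_. P)) {s \<in> space (PiM {..<n} (\<lambda>_. P)). (\<Sum>i<n. f (s i)) \<le> n * m + c}"
    \<comment> \<open>For positive \<open>n\<close> the normalizing denominator is positive and the
      inequality can be cleared of it.\<close>
    if n: "n > 0" for n
  proof -
    let ?Mn = "PiM {..<n} (\<lambda>_. P)" and ?r = "\<lambda>\<omega>::nat \<Rightarrow> 'a. restrict \<omega> {..<n}"
    have "sqrt (real n * \<sigma>\<^sup>2) > 0" "\<not> real n * \<sigma>\<^sup>2 < 0"
      using n \<sigma>(1) by (simp_all add: not_less)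
    then have "S n \<omega> \<le> c / sqrt (real n * \<sigma>\<^sup>2) \<longleftrightarrow> (\<Sum>i<n. f (\<omega> i)) \<le> n * m + c" for \<omega>
      unfolding S_def by (subst divide_le_cancel) (auto simp: sum_subtractf algebra_simps simp del: real_sqrt_gt_0_iff)
    then have "cdf (distr ?M borel (S n)) (c / sqrt (real n * \<sigma>\<^sup>2))
        = measure ?M {\<omega> \<in> space ?M. (\<Sum>i<n. f (\<omega> i)) \<le> n * m + c}"
      by (simp add: cdf_def measure_distr vimage_def Int_def conj_commute)
    \<comment> \<open>The event involves only the first \<open>n\<close> coordinates, so it is a
      preimage under restriction.\<close>
    also have "{\<omega> \<in> space ?M. (\<Sum>i<n. f (\<omega> i)) \<le> n * m + c}
        = ?r -` {s \<in> space ?Mn. (\<Sum>i<n. f (s i)) \<le> n * m + c} \<inter> space ?M"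
      by (auto simp: space_PiM)
    also have "measure ?M \<dots> = measure (distr ?M ?Mn ?r) {s \<in> space ?Mn. (\<Sum>i<n. f (s i)) \<le> n * m + c}"
      by (subst measure_distr) (auto intro!: measurable_restrict)
    also have "distr ?M ?Mn ?r = ?Mn"
      by (rule PP.distr_PiM_restrict_finite) auto
    finally show ?thesis .
  qed
  then have "\<forall>\<^sub>F n in sequentially. cdf (distr ?M borel (S n)) (c / sqrt (real n * \<sigma>\<^sup>2))
      = measure (PiM {..<n} (\<lambda>_. P)) {s \<in> space (PiM {..<n} (\<lambda>_. P)). (\<Sum>i<n. f (s i)) \<le> n * m + c}"
    by (rule eventually_mono[OF eventually_gt_at_top[of 0]])
  ultimately have "(\<lambda>n. measure (PiM {..<n} (\<lambda>_. P)) {s \<in> space (PiM {..<n} (\<lambda>_. P)). (\<Sum>i<n. f (s i)) \<le> real n * m + c})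
      \<longlonglongrightarrow> cdf std_normal_distribution 0"
    by (rule Lim_transform_eventually)
  then show ?thesis by (simp add: cdf_std_normal_0 m_def)
qed

section \<open>Mass of intervals and of costly points\<close>

text \<open>The law of \<open>X\<close> may leave a gap just above \<open>a\<close>, so
  \<open>a < X z\<close> alone does not give positive mass in between. The exceptional points are
  covered by countably many null intervals with rational right ends and one further point, null
  because there are no atoms.\<close>

lemma (in finite_measure) AE_measure_Ioc_pos:
  fixes X :: "'a \<Rightarrow> real"
  assumes X[measurable]: "X \<in> borel_measurable M"
    and cont: "\<And>x. measure M {z \<in> space M. X z = x} = 0"
  shows "AE z in M. a < X z \<longrightarrow> measure M {w \<in> space M. a < X w \<and> X w \<le> X z} > 0"
proof -
  define m where "m x = measure M {w \<in> space M. a < X w \<and> X w \<le> x}" for x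
  have mono: "m x \<le> m y" if "x \<le> y" for x y
    unfolding m_def using that by (intro finite_measure_mono) auto
  \<comment> \<open>A point \<open>x\<close> with \<open>m x = 0\<close> other than the largest one (if there is one) lies below a rational such point.\<close>
  define x0 where "x0 = (SOME x. m x = 0 \<and> (\<forall>y. m y = 0 \<longrightarrow> y \<le> x))"
  have "AE z in M. X z \<noteq> x0"
  proof -
    have "{z \<in> space M. X z = x0} \<in> null_sets M"
      using cont[of x0] by (auto simp: null_sets_def emeasure_eq_measure)
    then show ?thesis by (rule AE_I'[rotated 0]) auto
  qed
  moreover have "AE z in M. \<forall>q\<in>\<rat>. m q = 0 \<longrightarrow> \<not> (a < X z \<and> X z \<le> q)"
  proof (subst AE_ball_countable[OF countable_rat], intro ballI)
    fix q :: real
    show "AE z in M. m q = 0 \<longrightarrow> \<not> (a < X z \<and> X z \<le> q)"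
    proof (cases "m q = 0")
      case True
      then have "{w \<in> space M. a < X w \<and> X w \<le> q} \<in> null_sets M"
        by (auto simp: null_sets_def emeasure_eq_measure m_def)
      then show ?thesis by (rule AE_I'[rotated 0]) auto
    qed simp
  qed
  ultimately have "AE z in M. a < X z \<longrightarrow> m (X z) > 0"
  proof eventually_elim
    case (elim z)
    show ?case
    proof (intro impI, rule ccontr)
      assume a: "a < X z" and "\<not> m (X z) > 0"
      then have 0: "m (X z) = 0" by (simp add: m_def not_less measure_le_0_iff)
      have "\<exists>y>X z. m y = 0"
      proof (rule ccontr)
        assume "\<not> (\<exists>y>X z. m y = 0)"
        then have *: "\<forall>y. m y = 0 \<longrightarrow> y \<le> X z" by (auto simp: not_less)
        with 0 have "\<exists>x. m x = 0 \<and> (\<forall>y. m y = 0 \<longrightarrow> y \<le> x)" by blast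
        then have "m x0 = 0 \<and> (\<forall>y. m y = 0 \<longrightarrow> y \<le> x0)" unfolding x0_def by (rule someI_ex)
        with 0 * have "X z = x0" by (meson antisym)
        with elim show False by simp
      qed
      then obtain y where y: "X z < y" "m y = 0" by blast
      obtain q where q: "q \<in> \<rat>" "X z < q" "q < y" using Rats_dense_in_real[OF y(1)] by blast
      have "m q = 0" using mono[of q y] q y by (simp add: m_def measure_le_0_iff)
      with elim q a show False by auto
    qed
  qed
  then show ?thesis by (simp add: m_def)
qed

lemma measurable_obs [measurable]:
  "benefit \<in> borel_measurable borel" "cost \<in> borel_measurable borel" "charac \<in> borel_measurable borel"
  unfolding benefit_def[abs_def] cost_def[abs_def] charac_def[abs_def]
  by (intro borel_measurable_continuous_onI continuous_intros)+

text \<open>The defining property of conditional expectation turns the mass of costly points over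
  \<open>D\<close> into the integral of the conditional cost probability there. An integrand
  positive almost everywhere on a set of positive mass has a positive integral.\<close>

lemma measure_cost_pos:
  fixes P :: "obs measure"
  assumes P: "prob_space P" and sets: "sets P = sets borel" and D[measurable]: "D \<in> sets borel"
    and pos: "AE z in P. charac z \<in> D \<longrightarrow> cost_prob_given_charac P z > 0"
    and D_pos: "measure P {z. charac z \<in> D} > 0"
  shows "measure P {z. cost z = 1 \<and> charac z \<in> D} > 0"
proof -
  interpret prob_space P by fact
  note [measurable_cong] = sets
  have space: "space P = UNIV" using sets_eq_imp_space_eq[OF sets] by simp
  define F where "F = vimage_algebra (space P) charac borel"
  have "subalgebra P F"
    unfolding subalgebra_def F_def using space measurable_sets[of charac P borel]
    by (auto simp: sets_vimage_algebra2)
  then interpret finite_measure_subalgebra P F by unfold_locales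
  define f :: "obs \<Rightarrow> real" where "f = indicator {z. cost z = 1}"
  define r where "r = real_cond_exp P F f"
  let ?A = "{z. charac z \<in> D}"
  \<comment> \<open>Conditional expectation may be integrated over this event because it is
    determined by the characteristic alone.\<close>
  have A: "?A \<in> sets F"
    unfolding F_def space by (subst sets_vimage_algebra2) auto
  have [measurable]: "f \<in> borel_measurable P" by (simp add: f_def)
  have int_f: "integrable P f"
    by (rule integrable_const_bound[of _ 1]) (auto simp: f_def indicator_def)
  have int_r: "integrable P r" unfolding r_def by (rule real_cond_exp_int(1)[OF int_f])
  have "measure P {z. cost z = 1 \<and> charac z \<in> D} = (\<integral>z. indicator ?A z * f z \<partial>P)"
  proof -
    have "(\<lambda>z. indicator ?A z * f z) = indicator {z. cost z = 1 \<and> charac z \<in> D}"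
      by (auto simp: f_def indicator_def fun_eq_iff)
    then show ?thesis by (simp add: space)
  qed
  also have "\<dots> = (\<integral>z. indicator ?A z * r z \<partial>P)"
    using real_cond_exp_intA[OF int_f A] by (simp add: set_lebesgue_integral_def r_def)
  also have "\<dots> > 0"
  proof -
    have Ar: "integrable P (\<lambda>z. indicator ?A z * r z)"
      using integrable_mult_indicator[OF _ int_r, of ?A] by simp
    have pos': "AE z in P. z \<in> ?A \<longrightarrow> r z > 0"
      using pos by (simp add: r_def f_def F_def cost_prob_given_charac_def)
    then have nn: "AE z in P. 0 \<le> indicator ?A z * r z" by eventually_elim (auto simp: indicator_def)
    have "(\<integral>z. indicator ?A z * r z \<partial>P) \<noteq> 0"
    proof
      assume "(\<integral>z. indicator ?A z * r z \<partial>P) = 0"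
      then have "AE z in P. indicator ?A z * r z = 0"
        using integral_nonneg_eq_0_iff_AE[OF Ar nn] by simp
      with pos' have "AE z in P. z \<notin> ?A" by eventually_elim (auto simp: indicator_def)
      then have "measure P ?A = 0"
        by (subst prob_eq_0) auto
      with D_pos show False by simp
    qed
    moreover have "(\<integral>z. indicator ?A z * r z \<partial>P) \<ge> 0" by (rule integral_nonneg_AE[OF nn])
    ultimately show ?thesis by simp
  qed
  finally show ?thesis .
qed

text \<open>A threshold below all observations has zero sample cost, so for \<open>k \<ge> 0\<close>
  the sample problem is feasible and the default zero policy never arises.\<close>

lemma sample_analog_threshold:
  assumes g: "is_sample_analog threshold_policies k n s g" and k: "k \<ge> 0"
  obtains t where "g = indicator {..t}"
    "is_constrained_max threshold_policies (sample_welfare n s) (sample_budget n s) k g"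
proof -
  \<comment> \<open>Inserting 0 keeps the set nonempty when \<open>n = 0\<close>; subtracting 1 puts
    \<open>t0\<close> strictly below every observation.\<close>
  define t0 where "t0 = Min (insert 0 ((\<lambda>i. charac (s i)) ` {..<n})) - 1"
  have "t0 < charac (s i)" if "i < n" for i
  proof -
    have "t0 + 1 \<le> charac (s i)" unfolding t0_def using that by (auto intro!: Min_le)
    then show ?thesis by simp
  qed
  then have "sample_budget n s (indicator {..t0}) = 0"
    unfolding sample_budget_def by (auto intro!: sum.neutral simp: not_le)
  then have "\<exists>g'\<in>threshold_policies. sample_budget n s g' \<le> k"
    using k by (intro bexI[of _ "indicator {..t0}"]) (auto simp: threshold_policies_def)
  then have max: "is_constrained_max threshold_policies (sample_welfare n s) (sample_budget n s) k g"
    using g by (simp add: is_sample_analog_def)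
  then obtain t where "g = indicator {..t}"
    by (auto simp: is_constrained_max_def threshold_policies_def)
  with max show ?thesis using that by blast
qed

section \<open>The population problem\<close>

text \<open>The plateau is the interval from \<open>t_lo\<close> to \<open>t_hi\<close>, on which
  \<open>B\<close> stays at \<open>k\<close>. \<open>X_below\<close> and \<open>X_above\<close>
  yield \<open>0 < k\<close> and \<open>k < 1\<close>; \<open>X_between\<close> gives the plateau
  positive mass.\<close>

locale budget_plateau = prob_space P
  for P :: "obs measure" and t_lo t_hi k :: real +
  assumes sets_P: "sets P = sets borel"
    and W_exists: "\<And>g. g \<in> threshold_policies \<Longrightarrow> integrable P (\<lambda>z. benefit z * g (charac z))"
    and X_continuous: "\<And>x. measure P {z. charac z = x} = 0"
    and X_below: "measure P {z. charac z < t_lo} > 0"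
    and X_between: "measure P {z. charac z \<in> {t_lo..t_hi}} > 0"
    and X_above: "measure P {z. charac z > t_hi} > 0"
    and benefit_pos: "AE z in P. benefit z > 0"
    and cost_binary: "AE z in P. cost z \<in> {0, 1}"
    and cost_zero: "AE z in P. charac z \<in> {t_lo..t_hi} \<longrightarrow> cost z = 0"
    and cost_random: "AE z in P. charac z \<notin> {t_lo..t_hi} \<longrightarrow> cost_prob_given_charac P z \<in> {0<..<1}"
    and k_eq: "k = (\<integral>z. cost z * indicator {..t_lo} (charac z) \<partial>P)"
begin

declare sets_P [measurable_cong]

lemma space_P [simp]: "space P = UNIV"
  using sets_eq_imp_space_eq[OF sets_P] by simp

abbreviation W :: "real \<Rightarrow> real" where "W t \<equiv> welfare P (indicator {..t})"
abbreviation B :: "real \<Rightarrow> real" where "B t \<equiv> budget P (indicator {..t})"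

lemma t_lo_le_t_hi: "t_lo \<le> t_hi"
  using X_between by (rule_tac ccontr) auto

lemma B_eq: "B t = measure P {z. cost z = 1 \<and> charac z \<le> t}"
proof -
  have "B t = (\<integral>z. indicator {z. cost z = 1 \<and> charac z \<le> t} z \<partial>P)"
    unfolding budget_def using cost_binary
    by (intro integral_cong_AE) (auto simp: indicator_def elim!: eventually_mono)
  then show ?thesis by simp
qed

lemma k_eq_B: "k = B t_lo"
  by (simp add: k_eq budget_def)

lemma B_mono: "t \<le> u \<Longrightarrow> B t \<le> B u"
  unfolding B_eq by (intro finite_measure_mono) auto

lemma W_mono: "t \<le> u \<Longrightarrow> W t \<le> W u"
  unfolding welfare_def using benefit_pos
  by (intro integral_mono_AE W_exists) (auto simp: threshold_policies_def mult_left_mono elim!: eventually_mono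
      split: split_indicator)

lemma B_t_hi: "B t_hi = k"
proof -
  have "B t_hi = B t_lo"
    unfolding B_eq using cost_zero t_lo_le_t_hi
    by (intro finite_measure_eq_AE) (auto elim!: eventually_mono)
  then show ?thesis by (simp add: k_eq_B)
qed

text \<open>The hypothesis asks for mass above \<open>t_hi\<close>, not merely
  \<open>t > t_hi\<close>, since the law of the characteristic may have a gap there. That mass has
  positive conditional cost probability, which adds to \<open>B t_hi = k\<close>.\<close>

lemma B_gt_k:
  assumes "measure P {z. t_hi < charac z \<and> charac z \<le> t} > 0"
  shows "B t > k"
proof -
  have "AE z in P. charac z \<in> {t_hi<..t} \<longrightarrow> cost_prob_given_charac P z > 0"
    using cost_random by eventually_elim auto
  then have "measure P {z. cost z = 1 \<and> charac z \<in> {t_hi<..t}} > 0"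
    using assms prob_space_axioms by (intro measure_cost_pos sets_P) auto
  moreover have "t_hi < t"
  proof (rule ccontr)
    assume "\<not> t_hi < t"
    then have "{z. t_hi < charac z \<and> charac z \<le> t} = {}" by auto
    with assms show False by simp
  qed
  then have "{z. cost z = 1 \<and> charac z \<le> t}
     = {z. cost z = 1 \<and> charac z \<le> t_hi} \<union> {z. cost z = 1 \<and> charac z \<in> {t_hi<..t}}" by auto
  then have "B t = B t_hi + measure P {z. cost z = 1 \<and> charac z \<in> {t_hi<..t}}"
    unfolding B_eq by (simp only:) (rule finite_measure_Union, auto)
  ultimately show ?thesis by (simp add: B_t_hi)
qed

text \<open>Costly points have positive mass below \<open>t_lo\<close>, while the mass above
  \<open>t_hi\<close> is never counted. Strictness on both sides makes the cost count
  nondegenerate.\<close>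

lemma k_pos: "k > 0" and k_less_1: "k < 1"
proof -
  have "AE z in P. charac z \<in> {..<t_lo} \<longrightarrow> cost_prob_given_charac P z > 0"
    using cost_random by eventually_elim auto
  then have "0 < measure P {z. cost z = 1 \<and> charac z \<in> {..<t_lo}}"
    using X_below prob_space_axioms by (intro measure_cost_pos sets_P) auto
  also have "\<dots> \<le> k" unfolding k_eq_B B_eq by (intro finite_measure_mono) auto
  finally show "k > 0" .
  have "k \<le> measure P (space P - {z. charac z > t_hi})"
    unfolding k_eq_B B_eq using t_lo_le_t_hi by (intro finite_measure_mono) auto
  also have "\<dots> < 1" using X_above by (subst prob_compl) auto
  finally show "k < 1" .
qed

text \<open>Almost surely positive benefits on a plateau of positive mass give a strict gain, the
  source of the welfare loss constant.\<close>

lemma W_gap: "W t_lo < W t_hi"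
proof -
  have W: "integrable P (\<lambda>z. benefit z * indicator {..t} (charac z))" for t
    by (rule W_exists) (simp add: threshold_policies_def)
  \<comment> \<open>Both policies treat the endpoint \<open>t_lo\<close>; removing it loses no mass,
    as there are no atoms.\<close>
  have "{z. charac z \<in> {t_lo..t_hi}} = {z. charac z \<in> {t_lo<..t_hi}} \<union> {z. charac z = t_lo}"
    using t_lo_le_t_hi by auto
  then have "measure P {z. charac z \<in> {t_lo..t_hi}}
      = measure P {z. charac z \<in> {t_lo<..t_hi}} + measure P {z. charac z = t_lo}"
    by (simp only:) (rule finite_measure_Union, auto)
  then have pos: "measure P {z. charac z \<in> {t_lo<..t_hi}} > 0"
    using X_between X_continuous by simp
  show ?thesis
    unfolding welfare_def
  proof (rule integral_less_AE[OF W W, where A = "{z. charac z \<in> {t_lo<..t_hi}}"])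
    show "emeasure P {z. charac z \<in> {t_lo<..t_hi}} \<noteq> 0"
      using pos by (simp add: emeasure_eq_measure)
    show "AE z in P. z \<in> {z. charac z \<in> {t_lo<..t_hi}} \<longrightarrow>
       benefit z * indicator {..t_lo} (charac z) \<noteq> benefit z * indicator {..t_hi} (charac z)"
      using benefit_pos by eventually_elim (auto simp: indicator_def)
    show "AE z in P. benefit z * indicator {..t_lo} (charac z) \<le> benefit z * indicator {..t_hi} (charac z)"
      using benefit_pos by eventually_elim (use t_lo_le_t_hi in \<open>auto simp: indicator_def\<close>)
  qed auto
qed

lemma slack_less_t_lo: "B t < k \<Longrightarrow> t < t_lo"
  using B_mono[of t_lo t] by (auto simp: k_eq_B not_le[symmetric])

text \<open>Slack would force the threshold below \<open>t_lo\<close>, yet \<open>t_hi\<close> is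
  feasible and strictly better. The maximizing threshold need not be unique, so only its budget and
  a welfare bound are extracted.\<close>

lemma constrained_max:
  assumes "is_constrained_max threshold_policies (welfare P) (budget P) k g"
  obtains t where "g = indicator {..t}" "B t = k" "W t_hi \<le> W t"
proof -
  from assms obtain t where t: "g = indicator {..t}" "B t \<le> k" "W t_hi \<le> W t"
    using B_t_hi by (auto simp: is_constrained_max_def threshold_policies_def)
  have "\<not> B t < k"
  proof
    assume "B t < k"
    then have "W t \<le> W t_lo" by (intro W_mono less_imp_le slack_less_t_lo)
    with t W_gap show False by simp
  qed
  with t that show ?thesis by simp
qed

section \<open>The count of costly observations up to the plateau\<close>

text \<open>Almost surely a Bernoulli variable with mean \<open>k\<close>; its sum over the sample
  is the count S_n.\<close>

definition inframarginal_cost :: "obs \<Rightarrow> real" where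
  "inframarginal_cost z = cost z * indicator {..t_lo} (charac z)"

lemma measurable_inframarginal_cost [measurable]: "inframarginal_cost \<in> borel_measurable P"
  unfolding inframarginal_cost_def by measurable

lemma integral_inframarginal_cost: "integral\<^sup>L P inframarginal_cost = k"
  by (simp add: inframarginal_cost_def[abs_def] k_eq)

lemma integrable_inframarginal_cost: "integrable P inframarginal_cost"
  by (rule integrable_const_bound[of _ 1])
     (use cost_binary in \<open>auto simp: inframarginal_cost_def indicator_def elim!: eventually_mono\<close>)

lemma inframarginal_cost_square: "AE z in P. (inframarginal_cost z)\<^sup>2 = inframarginal_cost z"
  using cost_binary by eventually_elim (auto simp: inframarginal_cost_def split: split_indicator)

lemma integrable_inframarginal_cost_square: "integrable P (\<lambda>z. (inframarginal_cost z)\<^sup>2)"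
  by (rule integrable_cong_AE_imp[OF integrable_inframarginal_cost])
     (use inframarginal_cost_square in \<open>auto elim!: eventually_mono\<close>)

text \<open>Being almost surely idempotent, the variable has second moment \<open>k\<close>, hence
  variance \<open>k - k\<^sup>2\<close>.\<close>

lemma variance_inframarginal_cost: "variance inframarginal_cost > 0"
proof -
  have "expectation (\<lambda>z. (inframarginal_cost z)\<^sup>2) = k"
    unfolding integral_inframarginal_cost[symmetric]
    by (rule integral_cong_AE) (use inframarginal_cost_square in auto)
  then have "variance inframarginal_cost = k - k\<^sup>2"
    by (subst variance_eq[OF integrable_inframarginal_cost integrable_inframarginal_cost_square])
       (simp add: integral_inframarginal_cost)
  also have "\<dots> > 0" using k_pos k_less_1 by (simp add: power2_eq_square)
  finally show ?thesis .
qed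

section \<open>Behaviour of the sample rule on a given sample\<close>

text \<open>Collects almost sure properties so that the two lemmas on the sample rule can be argued
  sample by sample. The last clause excludes observations separated from \<open>t_hi\<close> by a
  null interval.\<close>

definition regular_sample :: "nat \<Rightarrow> (nat \<Rightarrow> obs) \<Rightarrow> bool" where
  "regular_sample n s \<longleftrightarrow> inj_on (\<lambda>i. charac (s i)) {..<n} \<and>
    (\<forall>i<n. benefit (s i) > 0 \<and> cost (s i) \<in> {0, 1} \<and>
       (charac (s i) \<in> {t_lo..t_hi} \<longrightarrow> cost (s i) = 0) \<and>
       (charac (s i) > t_hi \<longrightarrow> B (charac (s i)) > k))"

lemma AE_regular_sample: "AE s in sample_distr P n. regular_sample n s"
proof -
  have X: "charac \<in> borel_measurable P" by measurable
  have "AE z in P. t_hi < charac z \<longrightarrow> B (charac z) > k"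
    using AE_measure_Ioc_pos[OF X, of t_hi] X_continuous by (auto elim!: eventually_mono intro: B_gt_k)
  with benefit_pos cost_binary cost_zero
  have "AE z in P. benefit z > 0 \<and> cost z \<in> {0, 1} \<and> (charac z \<in> {t_lo..t_hi} \<longrightarrow> cost z = 0) \<and>
       (charac z > t_hi \<longrightarrow> B (charac z) > k)" (is "AE z in P. ?Q z")
    by eventually_elim auto
  then have "AE s in sample_distr P n. \<forall>i\<in>{..<n}. ?Q (s i)"
    unfolding sample_distr_def
    by (intro AE_finite_allI AE_PiM_component[where P = ?Q]) (auto intro: prob_space_axioms)
  moreover have "AE s in sample_distr P n. inj_on (\<lambda>i. charac (s i)) {..<n}"
    unfolding sample_distr_def using X_continuous
    by (intro AE_PiM_inj_on X prob_space_axioms) auto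
  ultimately show ?thesis
    by eventually_elim (auto simp: regular_sample_def)
qed

text \<open>A threshold at or above \<open>t_lo\<close> would pay for all the counted costs, which
  already exceed the sample budget.\<close>

lemma sample_analog_over_budget:
  assumes s: "regular_sample n s" and n: "n > 0"
    and g: "is_sample_analog threshold_policies k n s g"
    and over: "(\<Sum>i<n. inframarginal_cost (s i)) > n * k"
  obtains t where "g = indicator {..t}" "t < t_lo"
proof -
  obtain t where t: "g = indicator {..t}"
    "is_constrained_max threshold_policies (sample_welfare n s) (sample_budget n s) k g"
    using sample_analog_threshold[OF g] k_pos by auto
  then have feas: "(\<Sum>i<n. cost (s i) * indicator {..t} (charac (s i))) \<le> n * k"
    using n by (simp add: is_constrained_max_def sample_budget_def field_simps)
  have "t < t_lo"
  proof (rule ccontr)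
    assume "\<not> t < t_lo"
    then have "(\<Sum>i<n. inframarginal_cost (s i)) \<le> (\<Sum>i<n. cost (s i) * indicator {..t} (charac (s i)))"
      using s by (intro sum_mono) (auto simp: regular_sample_def inframarginal_cost_def indicator_def)
    with over feas show False by simp
  qed
  with t(1) that show ?thesis by blast
qed

text \<open>The slack of one unit pays for the first observation above \<open>t_hi\<close>, whatever
  it costs. Positive benefits force a maximizer to reach it, and regularity says that the true
  budget is then exceeded.\<close>

lemma sample_analog_under_budget:
  assumes s: "regular_sample n s" and n: "n > 0"
    and g: "is_sample_analog threshold_policies k n s g"
    and under: "(\<Sum>i<n. inframarginal_cost (s i)) \<le> n * k - 1"
    and above: "\<exists>i<n. charac (s i) > t_hi"
  obtains t where "g = indicator {..t}" "B t > k"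
proof -
  let ?x = "\<lambda>i. charac (s i)"
  obtain t where t: "g = indicator {..t}"
    "is_constrained_max threshold_policies (sample_welfare n s) (sample_budget n s) k g"
    using sample_analog_threshold[OF g] k_pos by auto
  define J where "J = {i. i < n \<and> ?x i > t_hi}"
  have "finite J" "J \<noteq> {}" using above by (auto simp: J_def)
  then obtain j where j: "j \<in> J" "\<And>i. i \<in> J \<Longrightarrow> ?x j \<le> ?x i"
    using ex_min_if_finite[of "?x ` J"] by (auto simp: not_less)
  have jn: "j < n" "?x j > t_hi" using j(1) by (auto simp: J_def)
  \<comment> \<open>Up to \<open>?x j\<close> the costs are those counted below the plateau, nothing
    on it, and at most one unit for \<open>j\<close>; without ties no other observation above
    \<open>t_hi\<close> is included.\<close>
  have "(\<Sum>i<n. cost (s i) * indicator {..?x j} (?x i))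
      \<le> (\<Sum>i<n. inframarginal_cost (s i) + (if i = j then 1 else 0))"
  proof (rule sum_mono)
    fix i assume "i \<in> {..<n}"
    then have i: "i < n" by simp
    have c: "cost (s i) \<in> {0, 1}" "?x i \<in> {t_lo..t_hi} \<longrightarrow> cost (s i) = 0"
      using s i by (auto simp: regular_sample_def)
    have "i = j" if "t_hi < ?x i" "?x i \<le> ?x j"
    proof -
      have "?x i = ?x j" using j(2)[of i] i that by (auto simp: J_def)
      then show ?thesis using s i jn by (auto simp: regular_sample_def dest: inj_onD)
    qed
    then show "cost (s i) * indicator {..?x j} (?x i) \<le> inframarginal_cost (s i) + (if i = j then 1 else 0)"
      using c t_lo_le_t_hi by (auto simp: inframarginal_cost_def indicator_def not_le)
  qed
  also have "\<dots> \<le> n * k" using under jn by (simp add: sum.distrib)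
  finally have "sample_budget n s (indicator {..?x j}) \<le> k"
    using n by (simp add: sample_budget_def field_simps)
  then have "sample_welfare n s (indicator {..?x j}) \<le> sample_welfare n s (indicator {..t})"
    using t by (auto simp: is_constrained_max_def threshold_policies_def)
  then have le: "(\<Sum>i<n. benefit (s i) * indicator {..?x j} (?x i)) \<le> (\<Sum>i<n. benefit (s i) * indicator {..t} (?x i))"
    using n by (simp add: sample_welfare_def divide_le_cancel)
  have "?x j \<le> t"
  proof (rule ccontr)
    assume lt: "\<not> ?x j \<le> t"
    \<comment> \<open>Stopping short of \<open>j\<close> gives up its strictly positive
      benefit.\<close>
    have "(\<Sum>i<n. benefit (s i) * indicator {..t} (?x i)) < (\<Sum>i<n. benefit (s i) * indicator {..?x j} (?x i))"
    proof (rule sum_strict_mono_ex1)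
      show "\<forall>i\<in>{..<n}. benefit (s i) * indicator {..t} (?x i) \<le> benefit (s i) * indicator {..?x j} (?x i)"
        using s lt by (auto simp: regular_sample_def indicator_def intro: less_imp_le)
      show "\<exists>i\<in>{..<n}. benefit (s i) * indicator {..t} (?x i) < benefit (s i) * indicator {..?x j} (?x i)"
        using s lt jn by (intro bexI[of _ j]) (auto simp: regular_sample_def indicator_def)
    qed simp
    with le show False by simp
  qed
  then have "B (?x j) \<le> B t" by (rule B_mono)
  moreover have "B (?x j) > k" using s jn by (auto simp: regular_sample_def)
  ultimately show ?thesis using t(1) that[of t] by simp
qed

section \<open>Squeezing event probabilities towards one half\<close>

text \<open>Up to null sets, \<open>E\<close> contains the event that the count is at most
  \<open>n * k - 1\<close>, except for samples with nothing above \<open>t_hi\<close>, and lies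
  inside the event that it is at most \<open>n * k\<close>. Both bounds tend to 1/2, so counts
  strictly between, left undecided, do not matter. \<open>E\<close> is abstract to serve both
  overspending and the absence of a welfare loss.\<close>

lemma measure_sample_event_tendsto_half:
  assumes E: "\<And>n. n > 0 \<Longrightarrow> {s \<in> space (sample_distr P n). E n s} \<in> sets (sample_distr P n)"
    and under: "\<And>n s. n > 0 \<Longrightarrow> s \<in> space (sample_distr P n) \<Longrightarrow> regular_sample n s \<Longrightarrow>
       (\<Sum>i<n. inframarginal_cost (s i)) \<le> n * k - 1 \<Longrightarrow> \<exists>i<n. charac (s i) > t_hi \<Longrightarrow> E n s"
    and over: "\<And>n s. n > 0 \<Longrightarrow> s \<in> space (sample_distr P n) \<Longrightarrow> regular_sample n s \<Longrightarrow>
       (\<Sum>i<n. inframarginal_cost (s i)) > n * k \<Longrightarrow> \<not> E n s"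
  shows "(\<lambda>n. measure (sample_distr P n) {s \<in> space (sample_distr P n). E n s}) \<longlonglongrightarrow> 1 / 2"
proof -
  define below where "below c n = measure (sample_distr P n) {s \<in> space (sample_distr P n).
     (\<Sum>i<n. inframarginal_cost (s i)) \<le> n * k + c}" for c n
  define miss where "miss n = measure (sample_distr P n) {s \<in> space (sample_distr P n).
     \<forall>i<n. s i \<notin> {z. charac z > t_hi}}" for n
  have below: "below c \<longlonglongrightarrow> 1 / 2" for c
    using iid_sum_le_tendsto_half[OF prob_space_axioms measurable_inframarginal_cost
      integrable_inframarginal_cost_square variance_inframarginal_cost, of c]
    by (simp add: below_def[abs_def] sample_distr_def integral_inframarginal_cost)
  have "miss \<longlonglongrightarrow> 0"
    using measure_PiM_all_not_in_tendsto_0[OF prob_space_axioms _ X_above]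
    by (simp add: miss_def[abs_def] sample_distr_def)
  then have lower: "(\<lambda>n. below (-1) n - miss n) \<longlonglongrightarrow> 1 / 2"
    using tendsto_diff[OF below] by fastforce
  have bounds: "below (-1) n - miss n \<le> measure (sample_distr P n) {s \<in> space (sample_distr P n). E n s} \<and>
      measure (sample_distr P n) {s \<in> space (sample_distr P n). E n s} \<le> below 0 n" if n: "n > 0" for n
  proof -
    let ?M = "sample_distr P n"
    interpret M: prob_space ?M
      unfolding sample_distr_def by (rule prob_space_PiM) (rule prob_space_axioms)
    have comp[measurable]: "(\<lambda>s. s i) \<in> measurable ?M P" if "i < n" for i
      unfolding sample_distr_def using that by (intro measurable_component_singleton) simp
    have [measurable]: "(\<lambda>s. \<Sum>i<n. inframarginal_cost (s i)) \<in> borel_measurable ?M"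
      by (intro borel_measurable_sum measurable_compose[OF comp]) auto
    have miss_sets: "{s \<in> space ?M. \<forall>i<n. s i \<notin> {z. charac z > t_hi}} \<in> sets ?M"
    proof -
      have "{s \<in> space ?M. \<forall>i\<in>{..<n}. \<not> t_hi < charac (s i)} \<in> sets ?M"
      proof (rule sets.sets_Collect_finite_All)
        fix i assume "i \<in> {..<n}"
        then have [measurable]: "(\<lambda>s. charac (s i)) \<in> borel_measurable ?M"
          by (intro measurable_compose[OF comp]) auto
        show "{s \<in> space ?M. \<not> t_hi < charac (s i)} \<in> sets ?M" by measurable
      qed simp
      also have "{s \<in> space ?M. \<forall>i\<in>{..<n}. \<not> t_hi < charac (s i)}
          = {s \<in> space ?M. \<forall>i<n. s i \<notin> {z. charac z > t_hi}}" by auto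
      finally show ?thesis .
    qed
    note AE = AE_regular_sample[of n] AE_space
    have "below (-1) n \<le> measure ?M ({s \<in> space ?M. E n s} \<union> {s \<in> space ?M. \<forall>i<n. s i \<notin> {z. charac z > t_hi}})"
      unfolding below_def
    proof (rule M.finite_measure_mono_AE)
      show "AE s in ?M. s \<in> {s \<in> space ?M. (\<Sum>i<n. inframarginal_cost (s i)) \<le> n * k + - 1} \<longrightarrow>
         s \<in> {s \<in> space ?M. E n s} \<union> {s \<in> space ?M. \<forall>i<n. s i \<notin> {z. charac z > t_hi}}"
        using AE
      proof eventually_elim
        case (elim s)
        then show ?case using under[OF n, of s] by (cases "\<exists>i<n. charac (s i) > t_hi") simp_all
      qed
    qed (intro sets.Un E[OF n] miss_sets)
    also have "\<dots> \<le> measure ?M {s \<in> space ?M. E n s} + miss n"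
      unfolding miss_def by (intro measure_Un_le E[OF n] miss_sets)
    finally have "below (-1) n - miss n \<le> measure ?M {s \<in> space ?M. E n s}" by simp
    moreover have "measure ?M {s \<in> space ?M. E n s} \<le> below 0 n"
      unfolding below_def
    proof (rule M.finite_measure_mono_AE)
      show "AE s in ?M. s \<in> {s \<in> space ?M. E n s} \<longrightarrow>
         s \<in> {s \<in> space ?M. (\<Sum>i<n. inframarginal_cost (s i)) \<le> n * k + 0}"
        using AE
      proof eventually_elim
        case (elim s)
        then show ?case using over[OF n, of s]
          by (cases "real n * k < (\<Sum>i<n. inframarginal_cost (s i))") (simp_all add: not_less)
      qed
    qed measurable
    ultimately show ?thesis by simp
  qed
  show ?thesis
  proof (rule tendsto_sandwich[OF _ _ lower below[of 0]])
    have pos: "\<forall>\<^sub>F n :: nat in sequentially. n > 0" by (rule eventually_gt_at_top)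
    show "\<forall>\<^sub>F n in sequentially. below (-1) n - miss n \<le> measure (sample_distr P n) {s \<in> space (sample_distr P n). E n s}"
      using pos by eventually_elim (simp add: bounds)
    show "\<forall>\<^sub>F n in sequentially. measure (sample_distr P n) {s \<in> space (sample_distr P n). E n s} \<le> below 0 n"
      using pos by eventually_elim (simp add: bounds)
  qed
qed

end

section \<open>Separation, and the limits for overspending and welfare loss\<close>

theorem proposition3p1:
  fixes P :: "obs measure"
    and t_lo t_hi k :: real
    and g_star :: policy
    and g_hat :: "nat \<Rightarrow> (nat \<Rightarrow> obs) \<Rightarrow> policy"
  assumes "prob_space P" and "sets P = sets borel"
    and W_exists: "\<And>g. g \<in> threshold_policies \<Longrightarrow> integrable P (\<lambda>z. benefit z * g (charac z))"
    and X_continuous: "\<And>x. measure P {z. charac z = x} = 0"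
    and X_below: "measure P {z. charac z < t_lo} > 0"
    and X_between: "measure P {z. charac z \<in> {t_lo..t_hi}} > 0"
    and X_above: "measure P {z. charac z > t_hi} > 0"
    and benefit_pos: "AE z in P. benefit z > 0"
    and cost_binary: "AE z in P. cost z \<in> {0, 1}"
    and cost_zero: "AE z in P. charac z \<in> {t_lo..t_hi} \<longrightarrow> cost z = 0"
    and cost_random: "AE z in P. charac z \<notin> {t_lo..t_hi} \<longrightarrow> cost_prob_given_charac P z \<in> {0<..<1}"
    and k_eq: "k = (\<integral>z. cost z * indicator {..t_lo} (charac z) \<partial>P)"
    and g_star: "is_constrained_max threshold_policies (welfare P) (budget P) k g_star"
    and g_hat: "\<And>n s. n > 0 \<Longrightarrow> s \<in> space (sample_distr P n) \<Longrightarrow>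
                  is_sample_analog threshold_policies k n s (g_hat n s)"
    and W_hat_measurable: "\<And>n. n > 0 \<Longrightarrow> (\<lambda>s. welfare P (g_hat n s)) \<in> borel_measurable (sample_distr P n)"
    and B_hat_measurable: "\<And>n. n > 0 \<Longrightarrow> (\<lambda>s. budget P (g_hat n s)) \<in> borel_measurable (sample_distr P n)"
  shows "(budget P g_star = k \<and>
          (\<exists>\<epsilon>>0. \<forall>g\<in>threshold_policies. budget P g \<le> k \<longrightarrow>
             \<bar>budget P g - budget P g_star\<bar> > 0 \<longrightarrow> welfare P g_star - welfare P g > \<epsilon>)) \<and>
         ((\<lambda>n. measure (sample_distr P n)
                 {s \<in> space (sample_distr P n). budget P (g_hat n s) > k}) \<longlonglongrightarrow> 1 / 2) \<and>
         (\<exists>\<epsilon>>0. (\<lambda>n. measure (sample_distr P n)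
                 {s \<in> space (sample_distr P n). welfare P g_star - welfare P (g_hat n s) \<ge> \<epsilon>})
            \<longlonglongrightarrow> 1 / 2)"
proof -
  interpret budget_plateau P t_lo t_hi k
    by (intro budget_plateau.intro budget_plateau_axioms.intro) fact+
  obtain u where u: "g_star = indicator {..u}" "B u = k" "W t_hi \<le> W u"
    using constrained_max[OF g_star] .
  \<comment> \<open>The benefit earned on the plateau. It bounds the loss from stopping below
    \<open>t_lo\<close>; half of it serves for the strict inequality in the separation
    condition.\<close>
  define \<delta> where "\<delta> = W t_hi - W t_lo"
  have \<delta>: "\<delta> > 0" using W_gap by (simp add: \<delta>_def)
  have loss: "W u - W t \<ge> \<delta>" if "t < t_lo" for t
    using W_mono[of t t_lo] u(3) that by (simp add: \<delta>_def)
  have sep: "W u - W t > \<delta> / 2" if "B t \<le> k" "B t \<noteq> k" for t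
    using loss[OF slack_less_t_lo[of t]] that \<delta> by simp
  have violation: "(\<lambda>n. measure (sample_distr P n)
      {s \<in> space (sample_distr P n). budget P (g_hat n s) > k}) \<longlonglongrightarrow> 1 / 2"
  proof (rule measure_sample_event_tendsto_half)
    fix n :: nat assume n: "n > 0"
    show "{s \<in> space (sample_distr P n). budget P (g_hat n s) > k} \<in> sets (sample_distr P n)"
      using B_hat_measurable[OF n] by measurable
    fix s assume s: "s \<in> space (sample_distr P n)" "regular_sample n s"
    show "budget P (g_hat n s) > k"
      if "(\<Sum>i<n. inframarginal_cost (s i)) \<le> n * k - 1" "\<exists>i<n. charac (s i) > t_hi"
      using sample_analog_under_budget[OF s(2) n g_hat[OF n s(1)] that] by metis
    show "\<not> budget P (g_hat n s) > k" if "(\<Sum>i<n. inframarginal_cost (s i)) > n * k"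
      using sample_analog_over_budget[OF s(2) n g_hat[OF n s(1)] that] B_mono k_eq_B
      by (metis less_imp_le not_less)
  qed
  \<comment> \<open>The loss occurs when the count is over budget, so the squeeze applies to its
    complement.\<close>
  have "(\<lambda>n. measure (sample_distr P n)
      {s \<in> space (sample_distr P n). \<not> welfare P g_star - welfare P (g_hat n s) \<ge> \<delta>}) \<longlonglongrightarrow> 1 / 2"
  proof (rule measure_sample_event_tendsto_half)
    fix n :: nat assume n: "n > 0"
    show "{s \<in> space (sample_distr P n). \<not> welfare P g_star - welfare P (g_hat n s) \<ge> \<delta>} \<in> sets (sample_distr P n)"
      using W_hat_measurable[OF n] by measurable
    fix s assume s: "s \<in> space (sample_distr P n)" "regular_sample n s"
    show "\<not> welfare P g_star - welfare P (g_hat n s) \<ge> \<delta>"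
      if under: "(\<Sum>i<n. inframarginal_cost (s i)) \<le> n * k - 1" "\<exists>i<n. charac (s i) > t_hi"
    proof -
      obtain t where t: "g_hat n s = indicator {..t}" "B t > k"
        using sample_analog_under_budget[OF s(2) n g_hat[OF n s(1)] under] .
      \<comment> \<open>The optimum spends exactly \<open>k\<close>, so an overspending threshold
        lies to its right and loses no welfare.\<close>
      then have "u \<le> t" using B_mono[of t u] u(2) by (rule_tac ccontr) simp
      then show ?thesis using W_mono[of u t] \<delta> t u by simp
    qed
    show "\<not> \<not> welfare P g_star - welfare P (g_hat n s) \<ge> \<delta>" if over: "(\<Sum>i<n. inframarginal_cost (s i)) > n * k"
    proof -
      obtain t where "g_hat n s = indicator {..t}" "t < t_lo"
        using sample_analog_over_budget[OF s(2) n g_hat[OF n s(1)] over] .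
      then show ?thesis using loss[of t] u by simp
    qed
  qed
  then have "(\<lambda>n. 1 - measure (sample_distr P n)
      {s \<in> space (sample_distr P n). \<not> welfare P g_star - welfare P (g_hat n s) \<ge> \<delta>}) \<longlonglongrightarrow> 1 - 1 / 2"
    by (intro tendsto_diff tendsto_const)
  moreover have "1 - measure (sample_distr P n)
      {s \<in> space (sample_distr P n). \<not> welfare P g_star - welfare P (g_hat n s) \<ge> \<delta>}
      = measure (sample_distr P n) {s \<in> space (sample_distr P n). welfare P g_star - welfare P (g_hat n s) \<ge> \<delta>}"
    if n: "n > 0" for n
  proof -
    interpret M: prob_space "sample_distr P n"
      unfolding sample_distr_def by (rule prob_space_PiM) (rule prob_space_axioms)
    have "{s \<in> space (sample_distr P n). welfare P g_star - welfare P (g_hat n s) \<ge> \<delta>} \<in> sets (sample_distr P n)"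
      using W_hat_measurable[OF n] by measurable
    then show ?thesis by (subst M.prob_neg) simp_all
  qed
  then have "\<forall>\<^sub>F n in sequentially. 1 - measure (sample_distr P n)
      {s \<in> space (sample_distr P n). \<not> welfare P g_star - welfare P (g_hat n s) \<ge> \<delta>}
      = measure (sample_distr P n) {s \<in> space (sample_distr P n). welfare P g_star - welfare P (g_hat n s) \<ge> \<delta>}"
    by (rule eventually_mono[OF eventually_gt_at_top[of 0]])
  ultimately have "(\<lambda>n. measure (sample_distr P n)
      {s \<in> space (sample_distr P n). welfare P g_star - welfare P (g_hat n s) \<ge> \<delta>}) \<longlonglongrightarrow> 1 - 1 / 2"
    by (rule Lim_transform_eventually)
  then have "\<exists>\<epsilon>>0. (\<lambda>n. measure (sample_distr P n)
      {s \<in> space (sample_distr P n). welfare P g_star - welfare P (g_hat n s) \<ge> \<epsilon>}) \<longlonglongrightarrow> 1 / 2"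
    using \<delta> by auto
  moreover have "\<exists>\<epsilon>>0. \<forall>g\<in>threshold_policies. budget P g \<le> k \<longrightarrow>
      \<bar>budget P g - budget P g_star\<bar> > 0 \<longrightarrow> welfare P g_star - welfare P g > \<epsilon>"
    by (rule exI[of _ "\<delta> / 2"]) (use \<delta> sep u in \<open>auto simp: threshold_policies_def\<close>)
  ultimately show ?thesis using violation u by simp
qed

end
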